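(* Let $(g,h)\in\exp\mathfrak t^0_3\times\exp\mathfrak t^0_{3,2}$ be a pair of group-like elements with $c_{B(0)}(h)=c_{AB(0)}(h)=0$ which satisfies the mixed pentagon equation in $\exp\mathfrak t^0_{4,2}$: $$h(t^{12},t^{23}_++t^{24}_+,t^{23}_-+t^{24}_-)\;h(t^{13}+t^{23}_++t^{23}_-,t^{34}_+,t^{34}_-)$$ $$=g(t^{23}_+,t^{34}_+)\;h(t^{12}+t^{13}+t^{23}_++t^{23}_-,t^{24}_++t^{34}_+,t^{24}_-+t^{34}_-)\;h(t^{12},t^{23}_+,t^{23}_-)$$ and the special action condition in $\exp\mathfrak t^0_{3,2}$: $$A+\mathrm{Ad}\big(h(A,B(0),B(1))^{-1}\big)(B(0))+\mathrm{Ad}\big(h(A,B(1),B(0))^{-1}\big)(B(1))+\mathrm{Ad}\big(h(A,B(0),B(1))^{-1}h(C,B(0),B(1))\big)(C)=0.$$ Then $h$ satisfies the octagon equation in $\exp\mathfrak t^0_{3,2}$: $$h(A,B(1),B(0))^{-1}\,h(C,B(1),B(0))\,h(C,B(0),B(1))^{-1}\,h(A,B(0),B(1))=1.$$ Here $C$ is defined by $A+B(0)+B(1)+C=0$.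
   Context: Let $\mathbf k$ be a field of characteristic $0$. For $n\geqslant2$, $\mathfrak t_{n,2}$ is the completed (with respect to the grading where generators have degree 1) $\mathbf k$-Lie algebra with generators $t^{1i}$ ($2\leqslant i\leqslant n$) and $t(a)^{ij}$ ($i\ne j$, $2\leqslant i,j\leqslant n$, $a\in\mathbf Z/2\mathbf Z$) and relations, for all $a,b\in\mathbf Z/2\mathbf Z$ and all distinct $i,j,k,l\in\{2,\dots,n\}$: $t(a)^{ij}=t(-a)^{ji}$; $[t(a)^{ij},t(a+b)^{ik}+t(b)^{jk}]=0$; $[t^{1i}+t^{1j}+\sum_c t(c)^{ij},t(a)^{ij}]=0$; $[t^{1i},t^{1j}+\sum_c t(c)^{ij}]=0$; $[t^{1i},t(a)^{jk}]=0$; $[t(a)^{ij},t(b)^{kl}]=0$ (sums over $c\in\mathbf Z/2\mathbf Z$). Write $t^{ij}_+=t(0)^{ij}$, $t^{ij}_-=t(1)^{ij}$. $\mathfrak t^0_{n,2}\subset\mathfrak t_{n,2}$ is the (completed) Lie subalgebra generated by all these generators except $t^{1n}$. $\mathfrak t^0_{3,2}$ is the completed free Lie algebra on $A:=t^{12}$, $B(0):=t^{23}_+$, $B(1):=t^{23}_-$. $\mathfrak t^0_3$ is the completed free Lie algebra over $\mathbf k$ on two generators $A,B$. $\exp\mathfrak g$ denotes the group of group-like elements (exponentials) in the completed enveloping algebra of $\mathfrak g$, and $\mathrm{Ad}(u)(x)=uxu^{-1}$. For $g\in\exp\mathfrak t^0_3$, $g(X,Y)$ is the image of $g$ under $A\mapsto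 X,B\mapsto Y$; for $h\in\exp\mathfrak t^0_{3,2}$, $h(X,Y_0,Y_1)$ is the image of $h$ under $A\mapsto X$, $B(0)\mapsto Y_0$, $B(1)\mapsto Y_1$. $c_W(h)$ is the coefficient of the noncommutative monomial $W$ in $h\in\mathbf k\langle\langle A,B(0),B(1)\rangle\rangle$. *)

theory Defs
  imports Complex_Main "HOL-Library.Z2"
begin

section \<open>Noncommutative formal power series\<close>

text \<open>
  An element of \<open>('x, 'k) ncs\<close> is a formal series in the noncommuting variables \<open>'x\<close>, given by
  its coefficient at each word. Over a finite set of variables this is the degree completion of the
  free associative algebra. Only the finitely many splittings of a word contribute to a product,
  so products make sense for every alphabet.
\<close>

typedef ('x, 'k) ncs = "UNIV :: ('x list \<Rightarrow> 'k) set"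
  morphisms coeff Abs_ncs ..

setup_lifting type_definition_ncs

lemma ncs_eqI: "(\<And>w. coeff f w = coeff g w) \<Longrightarrow> f = g"
  by transfer auto

instantiation ncs :: (type, ring_1) ring_1
begin

lift_definition zero_ncs :: "('a, 'b) ncs" is "\<lambda>_. 0" .
lift_definition one_ncs :: "('a, 'b) ncs" is "\<lambda>w. if w = [] then 1 else 0" .
lift_definition plus_ncs :: "('a, 'b) ncs \<Rightarrow> ('a, 'b) ncs \<Rightarrow> ('a, 'b) ncs" is "\<lambda>f g w. f w + g w" .
lift_definition minus_ncs :: "('a, 'b) ncs \<Rightarrow> ('a, 'b) ncs \<Rightarrow> ('a, 'b) ncs" is "\<lambda>f g w. f w - g w" .
lift_definition uminus_ncs :: "('a, 'b) ncs \<Rightarrow> ('a, 'b) ncs" is "\<lambda>f w. - f w" .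
lift_definition times_ncs :: "('a, 'b) ncs \<Rightarrow> ('a, 'b) ncs \<Rightarrow> ('a, 'b) ncs"
  is "\<lambda>f g w. \<Sum>i\<le>length w. f (take i w) * g (drop i w)" .

instance
proof
  fix a b c :: "('a, 'b) ncs"
  have reindex: "(\<Sum>j\<le>n. \<Sum>i\<le>j. F i (j - i)) = (\<Sum>i\<le>n. \<Sum>k\<le>n - i. F i k)"
    for n :: nat and F :: "nat \<Rightarrow> nat \<Rightarrow> 'b"
  proof -
    have "(\<Sum>j\<le>n. \<Sum>i\<le>j. F i (j - i)) = (\<Sum>(j, i)\<in>Sigma {..n} (\<lambda>j. {..j}). F i (j - i))"
      by (simp add: sum.Sigma)
    also have "\<dots> = (\<Sum>(i, k)\<in>Sigma {..n} (\<lambda>i. {..n - i}). F i k)"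
      by (rule sum.reindex_bij_witness
            [where i = "\<lambda>(i, k). (i + k, i)" and j = "\<lambda>(j, i). (i, j - i)"]) auto
    also have "\<dots> = (\<Sum>i\<le>n. \<Sum>k\<le>n - i. F i k)"
      by (simp add: sum.Sigma)
    finally show ?thesis .
  qed
  show "a * b * c = a * (b * c)"
  proof (transfer, rule ext)
    fix a b c :: "'a list \<Rightarrow> 'b" and w :: "'a list"
    let ?n = "length w"
    let ?F = "\<lambda>i k. a (take i w) * (b (take k (drop i w)) * c (drop (i + k) w))"
    have "(\<Sum>j\<le>?n. (\<Sum>i\<le>length (take j w). a (take i (take j w)) * b (drop i (take j w)))
             * c (drop j w)) = (\<Sum>j\<le>?n. \<Sum>i\<le>j. ?F i (j - i))"
    proof (rule sum.cong[OF refl])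
      fix j assume "j \<in> {..?n}"
      then show "(\<Sum>i\<le>length (take j w). a (take i (take j w)) * b (drop i (take j w)))
             * c (drop j w) = (\<Sum>i\<le>j. ?F i (j - i))"
        by (auto simp: sum_distrib_right mult.assoc drop_take min_def intro!: sum.cong)
    qed
    also have "\<dots> = (\<Sum>i\<le>?n. \<Sum>k\<le>?n - i. ?F i k)"
      by (rule reindex)
    also have "\<dots> = (\<Sum>i\<le>?n. a (take i w) * (\<Sum>k\<le>length (drop i w).
             b (take k (drop i w)) * c (drop k (drop i w))))"
      by (simp add: sum_distrib_left add.commute)
    finally show "(\<Sum>j\<le>?n. (\<Sum>i\<le>length (take j w). a (take i (take j w)) * b (drop i (take j w)))
             * c (drop j w)) = \<dots>" .
  qed
  show "1 * a = a"
  proof (transfer, rule ext)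
    fix a :: "'a list \<Rightarrow> 'b" and w :: "'a list"
    have "(\<Sum>i\<le>length w. (if take i w = [] then 1 else 0) * a (drop i w))
          = (\<Sum>i\<le>length w. if i = 0 then a w else 0)"
      by (rule sum.cong) auto
    then show "(\<Sum>i\<le>length w. (if take i w = [] then 1 else 0) * a (drop i w)) = a w"
      by simp
  qed
  show "a * 1 = a"
  proof (transfer, rule ext)
    fix a :: "'a list \<Rightarrow> 'b" and w :: "'a list"
    have "(\<Sum>i\<le>length w. a (take i w) * (if drop i w = [] then 1 else 0))
          = (\<Sum>i\<le>length w. if i = length w then a w else 0)"
      by (rule sum.cong) auto
    then show "(\<Sum>i\<le>length w. a (take i w) * (if drop i w = [] then 1 else 0)) = a w"
      by simp
  qed
  show "(0::('a, 'b) ncs) \<noteq> 1"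
    by transfer (auto simp: fun_eq_iff)
  show "(a + b) * c = a * c + b * c"
    by transfer (auto simp: distrib_right sum.distrib)
  show "a * (b + c) = a * b + a * c"
    by transfer (auto simp: distrib_left sum.distrib)
qed (transfer; auto simp: algebra_simps)+

end

lift_definition var :: "'x \<Rightarrow> ('x, 'k::ring_1) ncs" is "\<lambda>x w. if w = [x] then 1 else 0" .

lift_definition scale :: "'k::ring_1 \<Rightarrow> ('x, 'k) ncs \<Rightarrow> ('x, 'k) ncs" is "\<lambda>c f w. c * f w" .

lift_definition homogeneous_part :: "nat \<Rightarrow> ('x, 'k::ring_1) ncs \<Rightarrow> ('x, 'k) ncs"
  is "\<lambda>d f w. if length w = d then f w else 0" .

text \<open>The two-sided inverse; it exists whenever the constant coefficient is a unit.\<close>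

definition nc_inverse :: "('x, 'k::ring_1) ncs \<Rightarrow> ('x, 'k) ncs" where
  "nc_inverse f = (THE g. f * g = 1 \<and> g * f = 1)"

definition Ad :: "('x, 'k::ring_1) ncs \<Rightarrow> ('x, 'k) ncs \<Rightarrow> ('x, 'k) ncs" where
  "Ad u x = u * x * nc_inverse u"

definition lie_bracket :: "'a::ring \<Rightarrow> 'a \<Rightarrow> 'a" where
  "lie_bracket x y = x * y - y * x"

text \<open>
  The image of a series under the continuous algebra morphism \<open>x \<mapsto> \<phi> x\<close>, where all \<open>\<phi> x\<close> have
  zero constant coefficient: then only words no longer than \<open>v\<close> contribute to the coefficient at
  \<open>v\<close>, and there are finitely many of those since the source alphabet is finite.
\<close>

lift_definition subst :: "('x::finite \<Rightarrow> ('y, 'k::ring_1) ncs) \<Rightarrow> ('x, 'k) ncs \<Rightarrow> ('y, 'k) ncs"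
  is "\<lambda>\<phi> f v. \<Sum>w | length w \<le> length v. f w * coeff (prod_list (map \<phi> w)) v" .

text \<open>
  The coefficient of \<open>u \<otimes> v\<close> in \<open>\<Delta> f\<close>, where \<open>\<Delta>\<close> is the continuous algebra morphism with
  \<open>\<Delta> x = x \<otimes> 1 + 1 \<otimes> x\<close> for every variable \<open>x\<close>. Expanding \<open>\<Delta> (x\<^sub>1 \<dots> x\<^sub>m) = \<Prod> (x\<^sub>i \<otimes> 1 + 1 \<otimes> x\<^sub>i)\<close>
  gives one term for each set \<open>S\<close> of positions sent to the left factor.
\<close>

definition coproduct_coeff :: "('x::finite, 'k::ring_1) ncs \<Rightarrow> 'x list \<Rightarrow> 'x list \<Rightarrow> 'k" where
  "coproduct_coeff f u v = (\<Sum>w | length w = length u + length v.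
     coeff f w * of_nat (card {S. S \<subseteq> {..<length w} \<and> nths w S = u \<and> nths w (- S) = v}))"

text \<open>\<open>\<epsilon> f = 1\<close> and \<open>\<Delta> f = f \<otimes> f\<close>.\<close>

definition grouplike :: "('x::finite, 'k::ring_1) ncs \<Rightarrow> bool" where
  "grouplike f \<longleftrightarrow> coeff f [] = 1 \<and> (\<forall>u v. coproduct_coeff f u v = coeff f u * coeff f v)"


section \<open>Lie algebras given by generators and relations\<close>

text \<open>
  The free Lie algebra on a set of variables is realised, as usual, inside the free associative
  algebra, which is its enveloping algebra.
\<close>

inductive_set lie_subalgebra :: "('x, 'k::ring_1) ncs set \<Rightarrow> ('x, 'k) ncs set"
  for S :: "('x, 'k) ncs set" where
  gen: "x \<in> S \<Longrightarrow> x \<in> lie_subalgebra S"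
| zero: "0 \<in> lie_subalgebra S"
| add: "x \<in> lie_subalgebra S \<Longrightarrow> y \<in> lie_subalgebra S \<Longrightarrow> x + y \<in> lie_subalgebra S"
| scale: "x \<in> lie_subalgebra S \<Longrightarrow> scale c x \<in> lie_subalgebra S"
| bracket: "x \<in> lie_subalgebra S \<Longrightarrow> y \<in> lie_subalgebra S \<Longrightarrow> lie_bracket x y \<in> lie_subalgebra S"

definition free_lie :: "'x set \<Rightarrow> ('x, 'k::ring_1) ncs set" where
  "free_lie X = lie_subalgebra (var ` X)"

inductive_set lie_ideal :: "('x, 'k::ring_1) ncs set \<Rightarrow> ('x, 'k) ncs set \<Rightarrow> ('x, 'k) ncs set"
  for L R :: "('x, 'k) ncs set" where
  gen: "x \<in> R \<Longrightarrow> x \<in> lie_ideal L R"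
| zero: "0 \<in> lie_ideal L R"
| add: "x \<in> lie_ideal L R \<Longrightarrow> y \<in> lie_ideal L R \<Longrightarrow> x + y \<in> lie_ideal L R"
| scale: "x \<in> lie_ideal L R \<Longrightarrow> scale c x \<in> lie_ideal L R"
| bracket: "x \<in> L \<Longrightarrow> y \<in> lie_ideal L R \<Longrightarrow> lie_bracket x y \<in> lie_ideal L R"

definition free_assoc :: "'x set \<Rightarrow> ('x, 'k::ring_1) ncs set" where
  "free_assoc X = {f. finite {w. coeff f w \<noteq> 0} \<and> {w. coeff f w \<noteq> 0} \<subseteq> lists X}"

inductive_set two_sided_ideal :: "('x, 'k::ring_1) ncs set \<Rightarrow> ('x, 'k) ncs set \<Rightarrow> ('x, 'k) ncs set"
  for P R :: "('x, 'k) ncs set" where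
  gen: "x \<in> R \<Longrightarrow> x \<in> two_sided_ideal P R"
| zero: "0 \<in> two_sided_ideal P R"
| add: "x \<in> two_sided_ideal P R \<Longrightarrow> y \<in> two_sided_ideal P R \<Longrightarrow> x + y \<in> two_sided_ideal P R"
| left: "p \<in> P \<Longrightarrow> x \<in> two_sided_ideal P R \<Longrightarrow> p * x \<in> two_sided_ideal P R"
| right: "p \<in> P \<Longrightarrow> x \<in> two_sided_ideal P R \<Longrightarrow> x * p \<in> two_sided_ideal P R"

definition degree_completion :: "('x, 'k::ring_1) ncs set \<Rightarrow> ('x, 'k) ncs set" where
  "degree_completion J = {f. \<forall>d. homogeneous_part d f \<in> J}"

text \<open>
  If \<open>I\<close> is a graded Lie ideal of \<open>free_lie X\<close>, the enveloping algebra of \<open>free_lie X / I\<close> is the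
  quotient of \<open>free_assoc X\<close> by the two-sided ideal generated by \<open>I\<close>. For finite \<open>X\<close> its degree
  completion is the quotient of the algebra of all series in the variables \<open>X\<close> by the following ideal.
\<close>

definition envelope_ideal :: "'x set \<Rightarrow> ('x, 'k::ring_1) ncs set \<Rightarrow> ('x, 'k) ncs set" where
  "envelope_ideal X I = degree_completion (two_sided_ideal (free_assoc X) I)"


section \<open>The Lie algebras $\mathfrak{t}_{n,2}$ and $\mathfrak{t}^0_{n,2}$\<close>

text \<open>\<open>T1 i\<close> stands for $t^{1i}$ and \<open>T a i j\<close> for $t(a)^{ij}$, where \<open>a :: bit\<close> is in
  $\mathbf{Z}/2\mathbf{Z}$.\<close>

datatype tgen = T1 nat | T bit nat nat

definition t_gens :: "nat \<Rightarrow> tgen set" where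
  "t_gens n = {T1 i | i. i \<in> {2..n}} \<union> {T a i j | a i j. i \<in> {2..n} \<and> j \<in> {2..n} \<and> i \<noteq> j}"

definition t0_gens :: "nat \<Rightarrow> tgen set" where
  "t0_gens n = t_gens n - {T1 n}"

definition t_one :: "nat \<Rightarrow> (tgen, 'k::ring_1) ncs" where
  "t_one i = var (T1 i)"

definition t :: "bit \<Rightarrow> nat \<Rightarrow> nat \<Rightarrow> (tgen, 'k::ring_1) ncs" where
  "t a i j = var (T a i j)"

text \<open>Each family of relations only requires the indices occurring in it to be distinct.\<close>

definition t_relators :: "nat \<Rightarrow> (tgen, 'k::ring_1) ncs set" where
  "t_relators n =
     {t a i j - t (- a) j i | a i j. {i, j} \<subseteq> {2..n} \<and> distinct [i, j]} \<union>
     {lie_bracket (t a i j) (t (a + b) i k + t b j k) | a b i j k.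
        {i, j, k} \<subseteq> {2..n} \<and> distinct [i, j, k]} \<union>
     {lie_bracket (t_one i + t_one j + (t 0 i j + t 1 i j)) (t a i j) | a i j.
        {i, j} \<subseteq> {2..n} \<and> distinct [i, j]} \<union>
     {lie_bracket (t_one i) (t_one j + (t 0 i j + t 1 i j)) | i j.
        {i, j} \<subseteq> {2..n} \<and> distinct [i, j]} \<union>
     {lie_bracket (t_one i) (t a j k) | a i j k. {i, j, k} \<subseteq> {2..n} \<and> distinct [i, j, k]} \<union>
     {lie_bracket (t a i j) (t b k l) | a b i j k l.
        {i, j, k, l} \<subseteq> {2..n} \<and> distinct [i, j, k, l]}"

text \<open>$\mathfrak{t}_{n,2}$ is the degree completion of \<open>free_lie (t_gens n) / t_ideal n\<close>.\<close>

definition t_ideal :: "nat \<Rightarrow> (tgen, 'k::ring_1) ncs set" where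
  "t_ideal n = lie_ideal (free_lie (t_gens n)) (t_relators n)"

text \<open>
  The Lie subalgebra generated by \<open>t0_gens n\<close> is the image of \<open>free_lie (t0_gens n)\<close>, that is, its
  quotient by \<open>t0_ideal n\<close>; $\mathfrak{t}^0_{n,2}$ is the degree completion of this quotient.
\<close>

definition t0_ideal :: "nat \<Rightarrow> (tgen, 'k::ring_1) ncs set" where
  "t0_ideal n = t_ideal n \<inter> free_lie (t0_gens n)"

text \<open>
  For series \<open>p\<close>, \<open>q\<close> in the variables \<open>t0_gens n\<close>: equality of their classes in the completed
  enveloping algebra of $\mathfrak{t}^0_{n,2}$, which contains $\exp \mathfrak{t}^0_{n,2}$.
\<close>

definition eq_in_exp_t0 :: "nat \<Rightarrow> (tgen, 'k::ring_1) ncs \<Rightarrow> (tgen, 'k) ncs \<Rightarrow> bool" where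
  "eq_in_exp_t0 n p q \<longleftrightarrow> p - q \<in> envelope_ideal (t0_gens n) (t0_ideal n)"


section \<open>The free Lie algebras $\mathfrak{t}^0_3$ and $\mathfrak{t}^0_{3,2}$ and the equations\<close>

text \<open>
  The generators \<open>A\<close>, \<open>B\<close> of $\mathfrak{t}^0_3$, and the generators \<open>A\<close>, \<open>B(0)\<close>, \<open>B(1)\<close> of
  $\mathfrak{t}^0_{3,2}$. Both Lie algebras are free, so their completed enveloping algebras are
  \<open>(gen3, 'k) ncs\<close> and \<open>(gen32, 'k) ncs\<close>.
\<close>

datatype gen3 = A3 | B3
datatype gen32 = A32 | B32 bit

instance gen3 :: finite
proof
  have "(UNIV :: gen3 set) \<subseteq> {A3, B3}"
    using gen3.exhaust by blast
  then show "finite (UNIV :: gen3 set)"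
    by (rule finite_subset) simp
qed

instance gen32 :: finite
proof
  have "x \<in> {A32, B32 0, B32 1}" for x
    by (cases x) auto
  then have "(UNIV :: gen32 set) \<subseteq> {A32, B32 0, B32 1}"
    by blast
  then show "finite (UNIV :: gen32 set)"
    by (rule finite_subset) simp
qed

definition subst_g :: "(gen3, 'k::ring_1) ncs \<Rightarrow> ('y, 'k) ncs \<Rightarrow> ('y, 'k) ncs \<Rightarrow> ('y, 'k) ncs" where
  "subst_g g X Y = subst (case_gen3 X Y) g"

definition subst_h ::
  "(gen32, 'k::ring_1) ncs \<Rightarrow> ('y, 'k) ncs \<Rightarrow> ('y, 'k) ncs \<Rightarrow> ('y, 'k) ncs \<Rightarrow> ('y, 'k) ncs" where
  "subst_h h X Y0 Y1 = subst (case_gen32 X (\<lambda>a. if a = 0 then Y0 else Y1)) h"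

definition mixed_pentagon :: "(gen3, 'k::ring_1) ncs \<Rightarrow> (gen32, 'k) ncs \<Rightarrow> bool" where
  "mixed_pentagon g h \<longleftrightarrow> eq_in_exp_t0 4
     (subst_h h (t_one 2) (t 0 2 3 + t 0 2 4) (t 1 2 3 + t 1 2 4) *
      subst_h h (t_one 3 + t 0 2 3 + t 1 2 3) (t 0 3 4) (t 1 3 4))
     (subst_g g (t 0 2 3) (t 0 3 4) *
      subst_h h (t_one 2 + t_one 3 + t 0 2 3 + t 1 2 3) (t 0 2 4 + t 0 3 4) (t 1 2 4 + t 1 3 4) *
      subst_h h (t_one 2) (t 0 2 3) (t 1 2 3))"

definition special_action :: "(gen32, 'k::ring_1) ncs \<Rightarrow> bool" where
  "special_action h \<longleftrightarrow>
     (let A = var A32; B0 = var (B32 0); B1 = var (B32 1); C = - (A + B0 + B1) in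
      A + Ad (nc_inverse (subst_h h A B0 B1)) B0
        + Ad (nc_inverse (subst_h h A B1 B0)) B1
        + Ad (nc_inverse (subst_h h A B0 B1) * subst_h h C B0 B1) C = 0)"

definition octagon :: "(gen32, 'k::ring_1) ncs \<Rightarrow> bool" where
  "octagon h \<longleftrightarrow>
     (let A = var A32; B0 = var (B32 0); B1 = var (B32 1); C = - (A + B0 + B1) in
      nc_inverse (subst_h h A B1 B0) * subst_h h C B1 B0 *
      nc_inverse (subst_h h C B0 B1) * subst_h h A B0 B1 = 1)"

end

(*
  Put P = h(C,B(0),B(1))^-1 h(A,B(0),B(1)) and let sigma be the automorphism exchanging B(0) and
  B(1); it fixes A and C. The special action condition reads
  A + Ad(h^-1)(B(0)) + Ad(sigma(h)^-1)(B(1)) + Ad(P^-1)(C) = 0. Its first three terms have a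
  sigma-invariant sum, so Ad(P^-1)(C) = Ad(sigma(P)^-1)(C), that is, F = sigma(P) P^-1 commutes
  with C. As C is minus the sum of all variables, the coefficients of F depend only on the length
  of the word, whence sigma(F) = F. But sigma(F) = F^-1, so F^2 = 1, and F = 1 because its constant
  term is 1. The octagon equation is sigma(P)^-1 P = 1.
*)
theory Submission
  imports Defs
begin

section \<open>Inverses\<close>

lemma coeff_Nil_mult: "coeff (f * g) [] = coeff f [] * coeff g []"
  by transfer simp

lemma coeff_Nil_one: "coeff 1 [] = 1"
  by transfer simp

lemma coeff_add: "coeff (f + g) w = coeff f w + coeff g w"
  by transfer simp

text \<open>The equation \<open>f * g = 1\<close> at \<open>x # w\<close>, solved for the term with
  empty prefix. The other terms evaluate \<open>g\<close> only at suffixes of \<open>w\<close>, so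
  the recursion terminates.\<close>

fun right_inverse_coeff :: "('x list \<Rightarrow> 'k::division_ring) \<Rightarrow> 'x list \<Rightarrow> 'k" where
  "right_inverse_coeff f [] = inverse (f [])"
| "right_inverse_coeff f (x # w) = - inverse (f []) *
     (\<Sum>i\<le>length w. f (x # take i w) * right_inverse_coeff f (drop i w))"

text \<open>The nonvanishing of \<open>coeff g []\<close> lets the lemma be applied again to
  \<open>g\<close>.\<close>

lemma right_inverse_exists:
  fixes f :: "('x, 'k::division_ring) ncs"
  assumes "coeff f [] \<noteq> 0"
  shows "\<exists>g. f * g = 1 \<and> coeff g [] \<noteq> 0"
  using assms
proof transfer
  fix f :: "'x list \<Rightarrow> 'k"
  assume f: "f [] \<noteq> 0"
  let ?g = "right_inverse_coeff f"
  have "(\<Sum>i\<le>length w. f (take i w) * ?g (drop i w)) = (if w = [] then 1 else 0)" for w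
  proof (cases w)
    case Nil
    then show ?thesis using f by simp
  next
    case (Cons x v)
    \<comment> \<open>This is the \<open>i = 0\<close> summand; it cancels the rest of the
      sum.\<close>
    have "f [] * ?g (x # v) = - (\<Sum>i\<le>length v. f (x # take i v) * ?g (drop i v))"
      using f by (simp add: mult.assoc[symmetric])
    then show ?thesis
      using Cons by (simp add: sum.atMost_Suc_shift del: right_inverse_coeff.simps sum.atMost_Suc)
  qed
  then show "\<exists>g. (\<lambda>w. \<Sum>i\<le>length w. f (take i w) * g (drop i w)) =
      (\<lambda>w. if w = [] then 1 else 0) \<and> g [] \<noteq> 0"
    using f by (intro exI[of _ ?g] conjI ext) simp_all
qed

lemma nc_inverse_unique:
  assumes "f * g = 1" and "g * f = 1"
  shows "nc_inverse f = g"
  unfolding nc_inverse_def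
proof (rule the_equality)
  show "g' = g" if "f * g' = 1 \<and> g' * f = 1" for g'
    using that assms by (metis mult.assoc mult.left_neutral mult.right_neutral)
qed (use assms in simp)

text \<open>A right inverse \<open>g\<close> of \<open>f\<close> has a right inverse
  \<open>f'\<close> of its own, and \<open>f' = (f * g) * f' = f * (g * f') = f\<close>; so
  \<open>g\<close> is two-sided.\<close>

lemma nc_inverse_eqs:
  fixes f :: "('x, 'k::division_ring) ncs"
  assumes "coeff f [] \<noteq> 0"
  shows "f * nc_inverse f = 1" and "nc_inverse f * f = 1"
proof -
  obtain g where g: "f * g = 1" "coeff g [] \<noteq> 0"
    using right_inverse_exists[OF assms] by blast
  obtain f' where f': "g * f' = 1"
    using right_inverse_exists[OF g(2)] by blast
  have "f' = f"
    by (metis g(1) f' mult.assoc mult.left_neutral mult.right_neutral)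
  with g f' have "nc_inverse f = g"
    by (intro nc_inverse_unique) auto
  then show "f * nc_inverse f = 1" and "nc_inverse f * f = 1"
    using g f' \<open>f' = f\<close> by auto
qed

lemma nc_inverse_nc_inverse:
  fixes f :: "('x, 'k::division_ring) ncs"
  assumes "coeff f [] \<noteq> 0"
  shows "nc_inverse (nc_inverse f) = f"
  using nc_inverse_eqs[OF assms] by (intro nc_inverse_unique)

lemma nc_inverse_mult:
  fixes f g :: "('x, 'k::division_ring) ncs"
  assumes "coeff f [] \<noteq> 0" and "coeff g [] \<noteq> 0"
  shows "nc_inverse (f * g) = nc_inverse g * nc_inverse f"
proof (rule nc_inverse_unique)
  note eqs = nc_inverse_eqs[OF assms(1)] nc_inverse_eqs[OF assms(2)]
  show "f * g * (nc_inverse g * nc_inverse f) = 1"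
    by (metis eqs mult.assoc mult.right_neutral)
  show "nc_inverse g * nc_inverse f * (f * g) = 1"
    by (metis eqs mult.assoc mult.right_neutral)
qed

lemma coeff_Nil_nc_inverse:
  fixes f :: "('x, 'k::division_ring) ncs"
  assumes "coeff f [] = 1"
  shows "coeff (nc_inverse f) [] = 1"
  using arg_cong[OF nc_inverse_eqs(1)[of f], of "\<lambda>u. coeff u []"] assms
  by (simp add: coeff_Nil_mult coeff_Nil_one)

text \<open>In \<open>(f - 1) * (f + 1) = 0\<close> the second factor has constant coefficient 2,
  nonzero in characteristic 0, hence is invertible.\<close>

lemma square_eq_one_imp_eq_one:
  fixes f :: "('x, 'k::field_char_0) ncs"
  assumes "f * f = 1" and "coeff f [] = 1"
  shows "f = 1"
proof -
  have "coeff (f + 1) [] \<noteq> 0"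
    using assms(2) by (simp add: coeff_add coeff_Nil_one)
  from nc_inverse_eqs(1)[OF this] have "f - 1 = (f - 1) * (f + 1) * nc_inverse (f + 1)"
    by (simp add: mult.assoc)
  also have "(f - 1) * (f + 1) = 0"
    using assms(1) by (simp add: algebra_simps)
  finally show ?thesis by simp
qed


section \<open>Relabelling of variables\<close>

text \<open>For finite alphabets this is the continuous algebra morphism sending a variable \<open>y\<close> to the
  sum of the variables \<open>x\<close> with \<open>s x = y\<close>; it is contravariant in \<open>s\<close>.\<close>

lift_definition relabel :: "('x \<Rightarrow> 'y) \<Rightarrow> ('y, 'k::ring_1) ncs \<Rightarrow> ('x, 'k) ncs"
  is "\<lambda>s f w. f (map s w)" .

lemma relabel_one [simp]: "relabel s 1 = 1"
  by transfer auto

lemma relabel_add: "relabel s (f + g) = relabel s f + relabel s g"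
  by transfer simp

lemma relabel_uminus: "relabel s (- f) = - relabel s f"
  by transfer simp

lemma relabel_mult: "relabel s (f * g) = relabel s f * relabel s g"
  by transfer (simp add: take_map drop_map)

lemma relabel_var:
  assumes "inj s"
  shows "relabel s (var (s x)) = var x"
  using assms by transfer (auto simp: fun_eq_iff map_eq_Cons_conv dest: injD)

lemma relabel_nc_inverse:
  fixes f :: "('x, 'k::division_ring) ncs"
  assumes "coeff f [] \<noteq> 0"
  shows "relabel s (nc_inverse f) = nc_inverse (relabel s f)"
  by (rule sym, rule nc_inverse_unique) (simp_all flip: relabel_mult add: nc_inverse_eqs[OF assms])

lemma relabel_Ad:
  fixes f :: "('x, 'k::division_ring) ncs"
  assumes "coeff f [] \<noteq> 0"
  shows "relabel s (Ad f x) = Ad (relabel s f) (relabel s x)"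
  by (simp add: Ad_def relabel_mult relabel_nc_inverse[OF assms])

lemma relabel_prod_list: "relabel s (prod_list fs) = prod_list (map (relabel s) fs)"
  by (induction fs) (simp_all add: relabel_mult)

text \<open>Since \<open>map s\<close> preserves length, both sides sum over the same words
  \<open>w\<close> at a given \<open>v\<close>; multiplicativity of \<open>relabel s\<close> matches
  the summands.\<close>

lemma relabel_subst: "relabel s (subst \<phi> f) = subst (\<lambda>x. relabel s (\<phi> x)) f"
proof (rule ncs_eqI)
  fix v
  have "coeff (prod_list (map \<phi> w)) (map s v) =
      coeff (prod_list (map (\<lambda>x. relabel s (\<phi> x)) w)) v" for w
    using arg_cong[OF relabel_prod_list[of s "map \<phi> w"], of "\<lambda>u. coeff u v"]
    by (simp add: relabel.rep_eq comp_def)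
  then show "coeff (relabel s (subst \<phi> f)) v = coeff (subst (\<lambda>x. relabel s (\<phi> x)) f) v"
    by (simp add: relabel.rep_eq subst.rep_eq)
qed

lemma relabel_subst_h:
  "relabel s (subst_h h X Y0 Y1) = subst_h h (relabel s X) (relabel s Y0) (relabel s Y1)"
  unfolding subst_h_def relabel_subst
  by (rule arg_cong[of _ _ "\<lambda>\<phi>. subst \<phi> h"]) (auto simp: fun_eq_iff split: gen32.split)

lemma coeff_Nil_subst_h: "coeff (subst_h h X Y0 Y1) [] = coeff h []"
  by (simp add: subst_h_def subst.rep_eq one_ncs.rep_eq)


section \<open>The centralizer of the sum of all variables\<close>

lift_definition var_sum :: "('x, 'k::ring_1) ncs" is "\<lambda>w. if length w = 1 then 1 else 0" .

text \<open>Only the splitting after the first letter has a left part of length 1.\<close>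

lemma coeff_var_sum_mult:
  fixes f :: "('x, 'k::ring_1) ncs"
  shows "coeff (var_sum * f) (x # w) = coeff f w"
proof transfer
  fix f :: "'x list \<Rightarrow> 'k" and x w
  have "(\<Sum>i\<le>length (x # w). (if length (take i (x # w)) = 1 then 1 else 0) * f (drop i (x # w)))
      = (\<Sum>i\<le>length (x # w). if i = 1 then f w else 0)"
    by (rule sum.cong) (auto simp: min_def)
  then show "(\<Sum>i\<le>length (x # w). (if length (take i (x # w)) = 1 then 1 else 0)
      * f (drop i (x # w))) = f w"
    by (simp del: sum.atMost_Suc)
qed

lemma coeff_mult_var_sum:
  fixes f :: "('x, 'k::ring_1) ncs"
  shows "coeff (f * var_sum) (w @ [y]) = coeff f w"
proof transfer
  fix f :: "'x list \<Rightarrow> 'k" and w y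
  have "(\<Sum>i\<le>length (w @ [y]). f (take i (w @ [y])) *
        (if length (drop i (w @ [y])) = 1 then 1 else 0))
      = (\<Sum>i\<le>length (w @ [y]). if i = length w then f w else 0)"
    by (rule sum.cong) auto
  then show "(\<Sum>i\<le>length (w @ [y]). f (take i (w @ [y])) *
        (if length (drop i (w @ [y])) = 1 then 1 else 0)) = f w"
    by (simp del: sum.atMost_Suc)
qed

lemma commutes_var_sum_coeff_eq:
  assumes "f * var_sum = var_sum * f" and "length v = length w"
  shows "coeff f v = coeff f w"
proof -
  \<comment> \<open>Both sides of the commutation are read off at \<open>x # u @ [y]\<close>: one
    product drops the last letter, the other the first.\<close>
  have shift: "coeff f (x # u) = coeff f (u @ [y])" for x u y
    using coeff_mult_var_sum[of f "x # u" y] coeff_var_sum_mult[of f x "u @ [y]"] assms(1)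
    by simp
  \<comment> \<open>Each use of \<open>shift\<close> removes a leading letter and appends
    \<open>x\<close>, until only copies of \<open>x\<close> remain.\<close>
  have const: "coeff f (u @ replicate n x) = coeff f (replicate (length u + n) x)" for u n x
  proof (induction u arbitrary: n)
    case (Cons a u)
    have "coeff f ((a # u) @ replicate n x) = coeff f (u @ replicate (Suc n) x)"
      using shift[of a "u @ replicate n x" x] by (simp add: replicate_append_same)
    with Cons.IH[of "Suc n"] show ?case by simp
  qed simp
  show ?thesis
    \<comment> \<open>Here \<open>undefined\<close> serves as an arbitrary fixed letter.\<close>
    using const[of v 0 undefined] const[of w 0 undefined] assms(2) by simp
qed

lemma commutes_var_sum_imp_relabel_eq:
  assumes "f * var_sum = var_sum * f"
  shows "relabel s f = f"
  by (rule ncs_eqI, unfold relabel.rep_eq, rule commutes_var_sum_coeff_eq[OF assms]) simp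

lemma var_sum_gen32: "var_sum = var A32 + var (B32 0) + var (B32 1)"
proof (transfer, rule ext)
  fix w :: "gen32 list"
  consider "w = []" | "w = [A32]" | a where "w = [B32 a]" | x y u where "w = x # y # u"
    by (metis gen32.exhaust neq_Nil_conv)
  then show "(if length w = 1 then 1 else 0) =
      (if w = [A32] then 1 else 0) + (if w = [B32 0] then 1 else 0) +
      (if w = [B32 1] then 1 else (0::'a))"
  proof cases
    case (3 a)
    then show ?thesis by (cases a) auto
  qed auto
qed


section \<open>The octagon equation\<close>

text \<open>Multiplying \<open>nc_inverse P * x * P = nc_inverse Q * x * Q\<close> by
  \<open>Q\<close> on the left and by \<open>nc_inverse P\<close> on the right gives the
  claim.\<close>

lemma Ad_inverse_eq_imp_commute:
  fixes P Q :: "('x, 'k::division_ring) ncs"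
  assumes P: "coeff P [] \<noteq> 0" and Q: "coeff Q [] \<noteq> 0"
    and eq: "Ad (nc_inverse P) x = Ad (nc_inverse Q) x"
  shows "Q * nc_inverse P * x = x * (Q * nc_inverse P)"
proof -
  have "nc_inverse P * x * P = nc_inverse Q * x * Q"
    using eq by (simp add: Ad_def nc_inverse_nc_inverse P Q)
  then have "Q * (nc_inverse P * x * P) * nc_inverse P = Q * (nc_inverse Q * x * Q) * nc_inverse P"
    by simp
  then have "Q * nc_inverse P * x * (P * nc_inverse P) = Q * nc_inverse Q * x * (Q * nc_inverse P)"
    by (simp only: mult.assoc)
  then show ?thesis
    by (simp add: nc_inverse_eqs P Q)
qed

definition swap32 :: "gen32 \<Rightarrow> gen32" where
  "swap32 x = (case x of A32 \<Rightarrow> A32 | B32 a \<Rightarrow> B32 (a + 1))"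

lemma relabel_swap32_var:
  "relabel swap32 (var A32) = var A32"
  "relabel swap32 (var (B32 0)) = var (B32 1)"
  "relabel swap32 (var (B32 1)) = var (B32 0)"
proof -
  \<comment> \<open>An involution because \<open>1 + 1 = 0\<close> in \<open>bit\<close>; this
    yields the injectivity that \<open>relabel_var\<close> requires.\<close>
  have "swap32 (swap32 x) = x" for x
    by (simp add: swap32_def add.assoc split: gen32.split)
  then have "inj swap32"
    by (metis injI)
  note v = relabel_var[OF this]
  show "relabel swap32 (var A32) = var A32"
    using v[of A32] by (simp add: swap32_def)
  show "relabel swap32 (var (B32 0)) = var (B32 1)"
    using v[of "B32 1"] by (simp add: swap32_def)
  show "relabel swap32 (var (B32 1)) = var (B32 0)"
    using v[of "B32 0"] by (simp add: swap32_def)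
qed

lemma special_action_imp_octagon:
  fixes h :: "(gen32, 'k::field_char_0) ncs"
  assumes h1: "coeff h [] = 1" and special: "special_action h"
  shows "octagon h"
proof -
  define A B0 B1 C :: "(gen32, 'k) ncs"
    where "A = var A32" and "B0 = var (B32 0)" and "B1 = var (B32 1)" and "C = - (A + B0 + B1)"
  let ?\<sigma> = "relabel swap32"
  have \<sigma>: "?\<sigma> A = A" "?\<sigma> B0 = B1" "?\<sigma> B1 = B0"
    by (simp_all add: A_def B0_def B1_def relabel_swap32_var)
  then have \<sigma>C: "?\<sigma> C = C"
    by (simp only: C_def relabel_uminus relabel_add ac_simps)
  define H H' K K' where "H = subst_h h A B0 B1" and "H' = subst_h h A B1 B0"
    and "K = subst_h h C B0 B1" and "K' = subst_h h C B1 B0"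
  note HK_defs = H_def H'_def K_def K'_def
  have \<sigma>HK: "?\<sigma> H = H'" "?\<sigma> H' = H" "?\<sigma> K = K'" "?\<sigma> K' = K"
    by (simp_all add: HK_defs relabel_subst_h \<sigma> \<sigma>C)
  have HK1 [simp]: "coeff H [] = 1" "coeff H' [] = 1" "coeff K [] = 1" "coeff K' [] = 1"
    by (simp_all add: HK_defs coeff_Nil_subst_h h1)
  define P P' where "P = nc_inverse K * H" and "P' = nc_inverse K' * H'"
  have P1 [simp]: "coeff P [] = 1" "coeff P' [] = 1"
    by (simp_all add: P_def P'_def coeff_Nil_mult coeff_Nil_nc_inverse)
  have \<sigma>P: "?\<sigma> P = P'" "?\<sigma> P' = P"
    by (simp_all add: P_def P'_def relabel_mult relabel_nc_inverse \<sigma>HK)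
  \<comment> \<open>These are the forms in which the inverses occur in the special action condition
    and in the octagon.\<close>
  have invP: "nc_inverse P = nc_inverse H * K" "nc_inverse P' = nc_inverse H' * K'"
    by (simp_all add: P_def P'_def nc_inverse_mult nc_inverse_nc_inverse coeff_Nil_nc_inverse)
  have sp: "A + Ad (nc_inverse H) B0 + Ad (nc_inverse H') B1 + Ad (nc_inverse P) C = 0"
    using special
    by (simp add: special_action_def Let_def invP HK_defs C_def A_def B0_def B1_def)
  \<comment> \<open>The two middle terms are exchanged, so only the last term changes.\<close>
  from arg_cong[OF this, of ?\<sigma>]
  have sp': "A + Ad (nc_inverse H') B1 + Ad (nc_inverse H) B0 + Ad (nc_inverse P') C = ?\<sigma> 0"
    by (simp add: relabel_add relabel_Ad relabel_nc_inverse coeff_Nil_nc_inverse \<sigma> \<sigma>C \<sigma>HK \<sigma>P)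
  have "?\<sigma> 0 = (0 :: (gen32, 'k) ncs)"
    by transfer simp
  with sp sp' have "A + Ad (nc_inverse H) B0 + Ad (nc_inverse H') B1 + Ad (nc_inverse P) C =
      A + Ad (nc_inverse H) B0 + Ad (nc_inverse H') B1 + Ad (nc_inverse P') C"
    by (simp only: ac_simps)
  then have "Ad (nc_inverse P) C = Ad (nc_inverse P') C"
    by (simp only: add_left_cancel)
  then have commC: "P' * nc_inverse P * C = C * (P' * nc_inverse P)"
    by (intro Ad_inverse_eq_imp_commute) simp_all
  define F where "F = P' * nc_inverse P"
  have "C = - var_sum"
    by (simp add: C_def A_def B0_def B1_def var_sum_gen32)
  with commC have "?\<sigma> F = F"
    by (intro commutes_var_sum_imp_relabel_eq) (simp add: F_def)
  moreover have "?\<sigma> F = P * nc_inverse P'"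
    by (simp add: F_def relabel_mult relabel_nc_inverse \<sigma>P)
  \<comment> \<open>One factor \<open>F\<close> is replaced by \<open>P * nc_inverse P'\<close>, the
    other by its definition, so that \<open>P'\<close> cancels in the middle.\<close>
  ultimately have "F * F = P * (nc_inverse P' * P') * nc_inverse P"
    by (simp add: F_def mult.assoc)
  then have "F * F = 1"
    by (simp add: nc_inverse_eqs)
  then have "F = 1"
    by (rule square_eq_one_imp_eq_one) (simp add: F_def coeff_Nil_mult coeff_Nil_nc_inverse)
  then have "P' * (nc_inverse P * P) = P"
    by (simp flip: mult.assoc add: F_def)
  then have "P' = P"
    by (simp add: nc_inverse_eqs)
  then have "nc_inverse P' * P = 1"
    by (simp add: nc_inverse_eqs)
  then show ?thesis
    by (simp add: octagon_def Let_def invP P_def HK_defs C_def A_def B0_def B1_def mult.assoc)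
qed

theorem theorem0p3:
  fixes g :: "(gen3, 'k::field_char_0) ncs"
    and h :: "(gen32, 'k) ncs"
  assumes "grouplike g"
    and "grouplike h"
    and "coeff h [B32 0] = 0"
    and "coeff h [A32, B32 0] = 0"
    and "mixed_pentagon g h"
    and "special_action h"
  shows "octagon h"
  \<comment> \<open>The counit part of \<open>grouplike\<close> says that \<open>h\<close> has
    constant coefficient 1.\<close>
  using assms(2,6) by (intro special_action_imp_octagon) (auto simp: grouplike_def)

end
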